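(* Let $\mathcal J$ be a nowhere maximal ideal on $\omega$. For every maximal ideal $\mathcal I\supseteq\mathcal J$ on $\omega$, $$\mathtt{cof}^{\mathcal J}(\mathcal I)\ge\max\{\omega_1,\mathfrak z(\mathcal J)\}.$$
   Context: An ideal on an infinite set $X$ is a family $\mathcal I\subseteq\mathcal P(X)$ closed under subsets and finite unions, with $X\notin\mathcal I$ and $[X]^{<\omega}\subseteq\mathcal I$. Maximal means maximal under inclusion among ideals. $\mathcal J^+=\mathcal P(X)\setminus\mathcal J$, and $\mathcal J{\restriction}A=\{J\cap A:J\in\mathcal J\}$. The ideal $\mathcal J$ is nowhere maximal if for every $A\in\mathcal J^+$, $\mathcal J{\restriction}A$ is not a maximal ideal on $A$. A family $\mathcal A\subseteq\mathcal P(X)$ has the $\mathcal J$-finite union property ($\mathcal J$-f.u.p.) if $X\setminus\bigcup\mathcal A_0\in\mathcal J^+$ for every finite $\mathcal A_0\subseteq\mathcal A$. Define $$\mathfrak z(\mathcal J)=\min\{|\mathcal A|:\mathcal A\subseteq\mathcal J^+,\ \mathcal A\text{ has }\mathcal J\text{-f.u.p.},\ \forall B\in\mathcal J^+\ \exists A\in\mathcal A\ A\cap B\in\mathcal J^+\}$$ (for nowhere maximal $\mathcal J$ such families exist, so $\mathfrak z(\mathcal J)$ is defined). $\mathtt{cof}^{\mathcal J}(\mathcal I)=\min\{|\mathcal A|:\mathcal A\subseteq\mathcal I,\ \forall I\in\mathcal I\ \exists A\in\mathcal A\ I\setminus A\in\mathcal J\}$. *)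

theory Defs
  imports Main
begin

unbundle cardinal_syntax

text \<open>Set-theoretic ideals on an infinite set \<open>X\<close>; these are proper and contain
  all finite subsets of \<open>X\<close>.\<close>

definition ideal_on :: "'a set \<Rightarrow> 'a set set \<Rightarrow> bool" where
  "ideal_on X I \<longleftrightarrow>
     infinite X \<and> I \<subseteq> Pow X \<and>
     (\<forall>A\<in>I. \<forall>B. B \<subseteq> A \<longrightarrow> B \<in> I) \<and>
     (\<forall>A\<in>I. \<forall>B\<in>I. A \<union> B \<in> I) \<and>
     X \<notin> I \<and>
     (\<forall>F. F \<subseteq> X \<and> finite F \<longrightarrow> F \<in> I)"

definition maximal_ideal_on :: "'a set \<Rightarrow> 'a set set \<Rightarrow> bool" where
  "maximal_ideal_on X I \<longleftrightarrow>
     ideal_on X I \<and> (\<forall>K. ideal_on X K \<and> I \<subseteq> K \<longrightarrow> K = I)"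

definition positive_sets :: "'a set \<Rightarrow> 'a set set \<Rightarrow> 'a set set" where
  "positive_sets X J = Pow X - J"

definition restrict_ideal :: "'a set set \<Rightarrow> 'a set \<Rightarrow> 'a set set" where
  "restrict_ideal J A = {K \<inter> A | K. K \<in> J}"

definition nowhere_maximal :: "'a set \<Rightarrow> 'a set set \<Rightarrow> bool" where
  "nowhere_maximal X J \<longleftrightarrow>
     (\<forall>A\<in>positive_sets X J. \<not> maximal_ideal_on A (restrict_ideal J A))"

definition has_fup :: "'a set \<Rightarrow> 'a set set \<Rightarrow> 'a set set \<Rightarrow> bool" where
  "has_fup X J \<A> \<longleftrightarrow>
     (\<forall>\<A>\<^sub>0. \<A>\<^sub>0 \<subseteq> \<A> \<and> finite \<A>\<^sub>0 \<longrightarrow> X - \<Union>\<A>\<^sub>0 \<in> positive_sets X J)"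

text \<open>Cardinals are represented by well-order relations, as in
  \<open>HOL.BNF_Cardinal_Order_Relation\<close>. The minimum of the cardinalities of the members
  of a collection \<open>\<F>\<close> is the cardinality of a member of least cardinality; it is
  meaningful only if \<open>\<F>\<close> is nonempty.\<close>

definition min_card :: "'a set set \<Rightarrow> 'a rel" where
  "min_card \<F> = |SOME \<A>. \<A> \<in> \<F> \<and> (\<forall>\<B>\<in>\<F>. |\<A>| \<le>o |\<B>| )|"

lemma min_card_attained:
  assumes "\<F> \<noteq> {}"
  shows "\<exists>\<A>\<in>\<F>. min_card \<F> = |\<A>| \<and> (\<forall>\<B>\<in>\<F>. |\<A>| \<le>o |\<B>| )"
proof -
  have "\<exists>r\<in>card_of ` \<F>. \<forall>r'\<in>card_of ` \<F>. r \<le>o r'"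
    using assms by (intro exists_minim_Card_order) (auto simp: card_of_Card_order)
  then have "\<exists>\<A>. \<A> \<in> \<F> \<and> (\<forall>\<B>\<in>\<F>. |\<A>| \<le>o |\<B>| )"
    by blast
  from someI_ex[OF this] show ?thesis
    unfolding min_card_def by blast
qed

definition max_card :: "'a rel \<Rightarrow> 'a rel \<Rightarrow> 'a rel" where
  "max_card r s = (if r \<le>o s then s else r)"

text \<open>The cardinal \<open>\<zz>(J)\<close>; the collection below is nonempty whenever \<open>J\<close> is a
  nowhere maximal ideal on \<open>X\<close>.\<close>

definition z_card :: "'a set \<Rightarrow> 'a set set \<Rightarrow> 'a set rel" where
  "z_card X J = min_card {\<A>. \<A> \<subseteq> positive_sets X J \<and> has_fup X J \<A> \<and>
     (\<forall>B\<in>positive_sets X J. \<exists>A\<in>\<A>. A \<inter> B \<in> positive_sets X J)}"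

definition cof_card :: "'a set set \<Rightarrow> 'a set set \<Rightarrow> 'a set rel" where
  "cof_card J I = min_card {\<A>. \<A> \<subseteq> I \<and> (\<forall>K\<in>I. \<exists>A\<in>\<A>. K - A \<in> J)}"

text \<open>The first uncountable cardinal, the successor of \<open>|\<nat>|\<close>; \<open>cardSuc\<close> raises the
  underlying type, so this is a relation on \<open>nat set\<close>.\<close>

definition omega1 :: "nat set rel" where
  "omega1 = cardSuc natLeq"

end

(* Both bounds come from two facts: nowhere maximality splits every J-positive set into two
   J-positive pieces, and a maximal ideal contains one of any two disjoint sets.  Hence every
   J-positive B has a J-positive subset in I, so the J-positive members of a J-cofinal family
   in I witness z(J).  If such a family were countable, enumerated as e, choose an increasing
   sequence b in I with e n below b (n+1) and with J-positive differences b (n+1) - b n.  Split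
   each difference in two: the union of the first halves or the union of the second halves
   lies in I, yet modulo J it is covered by no e n. *)
theory Submission
  imports Defs
begin

lemma ideal_on_subset: "ideal_on X I \<Longrightarrow> A \<in> I \<Longrightarrow> B \<subseteq> A \<Longrightarrow> B \<in> I"
  unfolding ideal_on_def by (elim conjE) blast

lemma ideal_on_Un: "ideal_on X I \<Longrightarrow> A \<in> I \<Longrightarrow> B \<in> I \<Longrightarrow> A \<union> B \<in> I"
  unfolding ideal_on_def by (elim conjE) blast

lemma ideal_on_Pow: "ideal_on X I \<Longrightarrow> A \<in> I \<Longrightarrow> A \<subseteq> X"
  unfolding ideal_on_def by (elim conjE) blast

lemma ideal_on_proper: "ideal_on X I \<Longrightarrow> X \<notin> I"
  unfolding ideal_on_def by (elim conjE) blast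

lemma ideal_on_finite: "ideal_on X I \<Longrightarrow> F \<subseteq> X \<Longrightarrow> finite F \<Longrightarrow> F \<in> I"
  unfolding ideal_on_def by (elim conjE) blast

lemma ideal_on_Union:
  assumes "ideal_on X I" "finite \<A>" "\<A> \<subseteq> I"
  shows "\<Union>\<A> \<in> I"
  using assms(2,3)
proof (induction \<A>)
  case empty
  show ?case using ideal_on_finite[OF assms(1), of "{}"] by simp
next
  case (insert A \<A>)
  then show ?case using ideal_on_Un[OF assms(1)] by simp
qed

lemma ideal_on_Diff:
  assumes "ideal_on X I" "A \<in> I"
  shows "X - A \<notin> I"
proof
  assume "X - A \<in> I"
  then have "A \<union> (X - A) \<in> I" using assms ideal_on_Un by blast
  moreover have "A \<union> (X - A) = X" using ideal_on_Pow[OF assms] by blast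
  ultimately show False using ideal_on_proper[OF assms(1)] by simp
qed

text \<open>Were \<open>X - Z\<close> outside \<open>I\<close>, adjoining \<open>Z\<close> to
  \<open>I\<close> would generate a proper ideal strictly larger than \<open>I\<close>.\<close>

lemma maximal_ideal_on_Diff:
  assumes "maximal_ideal_on X I" "Z \<subseteq> X" "Z \<notin> I"
  shows "X - Z \<in> I"
proof (rule ccontr)
  assume *: "X - Z \<notin> I"
  have I: "ideal_on X I" using assms(1) unfolding maximal_ideal_on_def by blast
  define K where "K = {Y. \<exists>A\<in>I. Y \<subseteq> A \<union> Z}"
  have empty: "{} \<in> I" using ideal_on_finite[OF I] by simp
  have sub: "I \<subseteq> K" unfolding K_def by blast
  have "X \<notin> K"
  proof
    assume "X \<in> K"
    \<comment> \<open>Such a cover forces \<open>X - Z\<close> into \<open>A\<close>, hence into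
      \<open>I\<close>, against \<open>*\<close>.\<close>
    then obtain A where "A \<in> I" "X \<subseteq> A \<union> Z" unfolding K_def by blast
    then show False using * ideal_on_subset[OF I, of A "X - Z"] by blast
  qed
  moreover have "A \<union> B \<in> K" if A: "A \<in> K" and B: "B \<in> K" for A B
  proof -
    obtain C D where "C \<in> I" "A \<subseteq> C \<union> Z" "D \<in> I" "B \<subseteq> D \<union> Z"
      using A B unfolding K_def by blast
    then have "C \<union> D \<in> I" "A \<union> B \<subseteq> (C \<union> D) \<union> Z" using ideal_on_Un[OF I] by auto
    then show ?thesis unfolding K_def by blast
  qed
  moreover have "K \<subseteq> Pow X" using ideal_on_Pow[OF I] assms(2) unfolding K_def by blast
  moreover have "\<forall>A\<in>K. \<forall>B. B \<subseteq> A \<longrightarrow> B \<in> K" unfolding K_def by blast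
  moreover have "\<forall>F. F \<subseteq> X \<and> finite F \<longrightarrow> F \<in> K" using ideal_on_finite[OF I] sub by blast
  moreover have "infinite X" using I unfolding ideal_on_def by blast
  ultimately have "ideal_on X K" unfolding ideal_on_def by blast
  then have "K = I" using assms(1) sub unfolding maximal_ideal_on_def by blast
  moreover have "Z \<in> K" using empty unfolding K_def by blast
  ultimately show False using assms(3) by simp
qed

lemma maximal_ideal_on_disjoint:
  assumes "maximal_ideal_on X I" "A \<subseteq> X" "B \<subseteq> X" "A \<inter> B = {}"
  shows "A \<in> I \<or> B \<in> I"
proof -
  have I: "ideal_on X I" using assms(1) unfolding maximal_ideal_on_def by blast
  have "B \<subseteq> X - A" using assms by blast
  then show ?thesis
    using maximal_ideal_on_Diff[OF assms(1,2)] ideal_on_subset[OF I, of "X - A" B] by blast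
qed

text \<open>Positivity of \<open>D\<close> makes it infinite and keeps it out of the trace. Since
  the trace is an ideal, it can fail to be maximal only through a strictly larger ideal on
  \<open>D\<close>.\<close>

lemma ideal_on_restrict:
  assumes "ideal_on X J" "D \<in> positive_sets X J"
  shows "ideal_on D (restrict_ideal J D)"
proof -
  have D: "D \<subseteq> X" "D \<notin> J" using assms(2) unfolding positive_sets_def by auto
  \<comment> \<open>Downward closure of \<open>J\<close> turns traces on \<open>D\<close> into
    members of \<open>J\<close> lying inside \<open>D\<close>.\<close>
  have eq: "restrict_ideal J D = {A \<in> J. A \<subseteq> D}"
    unfolding restrict_ideal_def using ideal_on_subset[OF assms(1)] by blast
  have "infinite D" using D ideal_on_finite[OF assms(1)] by blast
  moreover have "A \<union> B \<in> J" if "A \<in> J" "B \<in> J" for A B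
    using ideal_on_Un[OF assms(1) that] .
  moreover have "B \<in> J" if "A \<in> J" "B \<subseteq> A" for A B
    using ideal_on_subset[OF assms(1) that] .
  moreover have "F \<in> J" if "F \<subseteq> D" "finite F" for F
    using ideal_on_finite[OF assms(1)] that D(1) by blast
  ultimately show ?thesis
    using D(2) unfolding eq ideal_on_def by auto
qed

text \<open>A strictly larger ideal \<open>K\<close> on \<open>D\<close> has a member
  \<open>C\<close> outside the trace. Both pieces are positive: if \<open>D - C\<close> were in
  \<open>J\<close>, then \<open>K\<close> would contain \<open>C\<close> and its complement in
  \<open>D\<close>.\<close>

lemma nowhere_maximal_split:
  assumes "ideal_on X J" "nowhere_maximal X J" "D \<in> positive_sets X J"
  obtains C where "C \<subseteq> D" "C \<in> positive_sets X J" "D - C \<in> positive_sets X J"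
proof -
  have D: "D \<subseteq> X" "D \<notin> J" using assms(3) unfolding positive_sets_def by auto
  have "\<not> maximal_ideal_on D (restrict_ideal J D)"
    using assms(2,3) unfolding nowhere_maximal_def by blast
  then obtain K where K: "ideal_on D K" "restrict_ideal J D \<subseteq> K" "K \<noteq> restrict_ideal J D"
    using ideal_on_restrict[OF assms(1,3)] unfolding maximal_ideal_on_def by blast
  then obtain C where C: "C \<in> K" "C \<notin> restrict_ideal J D" by blast
  have sub: "C \<subseteq> D" using ideal_on_Pow[OF K(1) C(1)] .
  have "C \<notin> J" using C(2) sub unfolding restrict_ideal_def by blast
  moreover have "D - C \<notin> J"
  proof
    assume "D - C \<in> J"
    then have "D - C \<in> K" using K(2) unfolding restrict_ideal_def by blast
    then show False using ideal_on_Diff[OF K(1) C(1)] by simp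
  qed
  ultimately show ?thesis using that[of C] sub D unfolding positive_sets_def by blast
qed

lemma maximal_ideal_on_positive_subset:
  assumes "ideal_on X J" "nowhere_maximal X J" "maximal_ideal_on X I"
    and "B \<in> positive_sets X J"
  obtains K where "K \<subseteq> B" "K \<in> I" "K \<in> positive_sets X J"
proof -
  obtain C where C: "C \<subseteq> B" "C \<in> positive_sets X J" "B - C \<in> positive_sets X J"
    using nowhere_maximal_split[OF assms(1,2,4)] .
  have "C \<in> I \<or> B - C \<in> I"
    using maximal_ideal_on_disjoint[OF assms(3), of C "B - C"] C
    unfolding positive_sets_def by blast
  then show ?thesis using C that by blast
qed

lemma min_card_le: "\<A> \<in> \<F> \<Longrightarrow> min_card \<F> \<le>o |\<A>|"
proof -
  assume "\<A> \<in> \<F>"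
  moreover from this have "\<F> \<noteq> {}" by blast
  ultimately show ?thesis using min_card_attained[of \<F>] by auto
qed

lemma z_card_le_cofinal:
  assumes J: "ideal_on X J" and "nowhere_maximal X J" and I: "maximal_ideal_on X I"
    and "J \<subseteq> I" and "\<A> \<subseteq> I" and cof: "\<forall>K\<in>I. \<exists>A\<in>\<A>. K - A \<in> J"
  shows "z_card X J \<le>o |\<A>|"
proof -
  have idI: "ideal_on X I" using I unfolding maximal_ideal_on_def by blast
  \<comment> \<open>\<open>z_card\<close> admits only families of positive sets. Discarding the
    members in \<open>J\<close> is harmless, because any \<open>A\<close> that meets
    \<open>B\<close> in a positive set is itself positive.\<close>
  define \<B> where "\<B> = \<A> \<inter> positive_sets X J"
  have "has_fup X J \<B>"
    unfolding has_fup_def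
  proof (intro allI impI)
    fix \<C> assume "\<C> \<subseteq> \<B> \<and> finite \<C>"
    then have "\<Union>\<C> \<in> I" using ideal_on_Union[OF idI] assms(5) unfolding \<B>_def by blast
    then show "X - \<Union>\<C> \<in> positive_sets X J"
      using ideal_on_Diff[OF idI] assms(4) unfolding positive_sets_def by blast
  qed
  moreover have "\<exists>A\<in>\<B>. A \<inter> B \<in> positive_sets X J" if B: "B \<in> positive_sets X J" for B
  proof -
    obtain K where K: "K \<subseteq> B" "K \<in> I" "K \<in> positive_sets X J"
      using maximal_ideal_on_positive_subset[OF assms(1-3) B] .
    obtain A where A: "A \<in> \<A>" "K - A \<in> J" using cof K(2) by blast
    \<comment> \<open>As \<open>K\<close> lies inside \<open>B\<close>, it is covered by
      \<open>K - A\<close> and \<open>A \<inter> B\<close>; these cannot both be in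
      \<open>J\<close>.\<close>
    have AB: "A \<inter> B \<notin> J"
    proof
      assume "A \<inter> B \<in> J"
      then have "(K - A) \<union> (A \<inter> B) \<in> J" using A ideal_on_Un[OF J] by blast
      then have "K \<in> J" using ideal_on_subset[OF J] K(1) by blast
      then show False using K(3) unfolding positive_sets_def by blast
    qed
    then have "A \<notin> J" using ideal_on_subset[OF J] by blast
    moreover have "A \<subseteq> X" using A(1) assms(5) ideal_on_Pow[OF idI] by blast
    ultimately show ?thesis using A(1) AB unfolding \<B>_def positive_sets_def by blast
  qed
  ultimately have "z_card X J \<le>o |\<B>|"
    unfolding z_card_def by (intro min_card_le) (auto simp: \<B>_def)
  moreover have "|\<B>| \<le>o |\<A>|" unfolding \<B>_def by (intro card_of_mono1) auto
  ultimately show ?thesis by (rule ordLeq_transitive)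
qed

lemma no_countable_cofinal:
  fixes e :: "nat \<Rightarrow> 'a set"
  assumes J: "ideal_on X J" and nm: "nowhere_maximal X J" and I: "maximal_ideal_on X I"
    and "J \<subseteq> I" and e: "\<And>n. e n \<in> I"
  shows "\<exists>S\<in>I. \<forall>n. S - e n \<notin> J"
proof -
  have idI: "ideal_on X I" using I unfolding maximal_ideal_on_def by blast
  \<comment> \<open>The implication sits under the quantifier so that choice yields a total function
    \<open>k\<close>.\<close>
  have "\<exists>K. A \<in> I \<longrightarrow> K \<in> I \<and> K - A \<notin> J" for A
  proof (cases "A \<in> I")
    case True
    then have "X - A \<in> positive_sets X J"
      using ideal_on_Diff[OF idI] assms(4) unfolding positive_sets_def by blast
    then obtain K where K: "K \<subseteq> X - A" "K \<in> I" "K \<in> positive_sets X J"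
      using maximal_ideal_on_positive_subset[OF J nm I] by blast
    then have "K - A = K" by blast
    then show ?thesis using K unfolding positive_sets_def by auto
  qed simp
  then obtain k where k: "\<And>A. A \<in> I \<Longrightarrow> k A \<in> I \<and> k A - A \<notin> J" by metis
  \<comment> \<open>Each stage absorbs \<open>e n\<close>, and \<open>k A\<close> makes the
    increment positive.\<close>
  define b where "b = rec_nat {} (\<lambda>n A. A \<union> e n \<union> k A)"
  have b_Suc: "b (Suc n) = b n \<union> e n \<union> k (b n)" for n unfolding b_def by simp
  have b_I: "b n \<in> I" for n
  proof (induction n)
    case 0
    show ?case unfolding b_def using ideal_on_finite[OF idI] by simp
  next
    case (Suc n)
    then show ?case unfolding b_Suc using e k ideal_on_Un[OF idI] by blast
  qed
  have b_mono: "b m \<subseteq> b n" if "m \<le> n" for m n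
    using lift_Suc_mono_le[of b, OF _ that] b_Suc by blast
  define d where "d n = b (Suc n) - b n" for n
  have d_pos: "d n \<in> positive_sets X J" for n
  proof -
    have "k (b n) - b n \<subseteq> d n" unfolding d_def b_Suc by blast
    then have "d n \<notin> J" using k[OF b_I[of n]] ideal_on_subset[OF J] by blast
    then show ?thesis
      using ideal_on_Pow[OF idI b_I[of "Suc n"]] unfolding d_def positive_sets_def by blast
  qed
  have d_disj: "d m \<inter> d n = {}" if "m \<noteq> n" for m n
  proof (cases "m < n")
    case True
    then show ?thesis using b_mono[of "Suc m" n] unfolding d_def by auto
  next
    case False
    then show ?thesis using that b_mono[of "Suc n" m] unfolding d_def by auto
  qed
  have "\<exists>C. C \<subseteq> d n \<and> C \<in> positive_sets X J \<and> d n - C \<in> positive_sets X J" for n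
    using nowhere_maximal_split[OF J nm d_pos] by blast
  then obtain c where c: "\<And>n. c n \<subseteq> d n" "\<And>n. c n \<notin> J" "\<And>n. d n - c n \<notin> J"
    unfolding positive_sets_def by (metis DiffD2)
  \<comment> \<open>Stated for arbitrary positive pieces \<open>s n\<close> of the differences, so
    that it serves both families of halves.\<close>
  have uncovered: "S - e n \<notin> J" if S: "\<And>n. s n \<subseteq> S \<inter> d n" "\<And>n. s n \<notin> J" for S s n
  proof
    assume *: "S - e n \<in> J"
    \<comment> \<open>The index is \<open>Suc n\<close> because \<open>e n\<close> is first absorbed
      in \<open>b (Suc n)\<close>, from which \<open>d (Suc n)\<close> is disjoint.\<close>
    have "s (Suc n) \<subseteq> S - e n" using S(1)[of "Suc n"] unfolding d_def b_Suc[of n] by blast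
    then show False using * S(2) ideal_on_subset[OF J] by blast
  qed
  have d_X: "d n \<subseteq> X" for n using d_pos unfolding positive_sets_def by blast
  have "(\<Union>n. c n) \<inter> (\<Union>n. d n - c n) = {}"
  proof -
    have "c m \<inter> (d n - c n) = {}" for m n using c(1)[of m] d_disj[of m n] by (cases "m = n") auto
    then show ?thesis by blast
  qed
  then have "(\<Union>n. c n) \<in> I \<or> (\<Union>n. d n - c n) \<in> I"
    using c(1) d_X by (intro maximal_ideal_on_disjoint[OF I]) blast+
  moreover have "(\<Union>n. c n) - e n \<notin> J" for n
    using c by (intro uncovered[of c]) auto
  moreover have "(\<Union>n. d n - c n) - e n \<notin> J" for n
    using c by (intro uncovered[of "\<lambda>n. d n - c n"]) auto
  ultimately show ?thesis by blast
qed

text \<open>A smaller cofinal family would be countable, hence the range of a sequence, which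
  \<open>no_countable_cofinal\<close> refutes.\<close>

lemma cardSuc_natLeq_le_cofinal:
  assumes J: "ideal_on X J" and nm: "nowhere_maximal X J" and I: "maximal_ideal_on X I"
    and "J \<subseteq> I" and "\<A> \<subseteq> I" and cof: "\<forall>K\<in>I. \<exists>A\<in>\<A>. K - A \<in> J"
  shows "cardSuc natLeq \<le>o |\<A>|"
proof (rule ccontr)
  assume "\<not> cardSuc natLeq \<le>o |\<A>|"
  then have "\<not> natLeq <o |\<A>|"
    using cardSuc_least[OF natLeq_Card_order card_of_Card_order] by blast
  then have "|\<A>| \<le>o natLeq"
    using not_ordLess_iff_ordLeq[OF card_of_Well_order natLeq_Well_order] by blast
  then have "|\<A>| \<le>o |UNIV :: nat set|"
    by (rule ordLeq_ordIso_trans[OF _ ordIso_symmetric[OF card_of_nat]])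
  \<comment> \<open>Some member must handle \<open>{}\<close>, which lies in \<open>I\<close>; a
    nonempty countable family is the range of a total function on the naturals.\<close>
  moreover have "\<A> \<noteq> {}"
    using cof assms(4) ideal_on_finite[OF J, of "{}"] by auto
  ultimately obtain e :: "nat \<Rightarrow> 'a set" where e: "e ` UNIV = \<A>"
    using card_of_ordLeq2 by metis
  then have "\<And>n. e n \<in> I" using assms(5) by blast
  then obtain S where "S \<in> I" "\<forall>n. S - e n \<notin> J"
    using no_countable_cofinal[OF J nm I assms(4)] by blast
  then show False using cof e by blast
qed

theorem proposition6p9:
  fixes J I :: "nat set set"
  assumes "ideal_on UNIV J"
    and "nowhere_maximal UNIV J"
    and "maximal_ideal_on UNIV I"
    and "J \<subseteq> I"
  shows "max_card omega1 (z_card UNIV J) \<le>o cof_card J I"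
proof -
  have "{} \<in> J" using ideal_on_finite[OF assms(1)] by simp
  \<comment> \<open>\<open>I\<close> is cofinal in itself, so the minimum defining
    \<open>cof_card\<close> is attained.\<close>
  then have "\<forall>K\<in>I. \<exists>A\<in>I. K - A \<in> J"
    using Diff_cancel by metis
  then have "{\<A>. \<A> \<subseteq> I \<and> (\<forall>K\<in>I. \<exists>A\<in>\<A>. K - A \<in> J)} \<noteq> {}"
    by blast
  then obtain \<A> where \<A>: "\<A> \<subseteq> I" "\<forall>K\<in>I. \<exists>A\<in>\<A>. K - A \<in> J" "cof_card J I = |\<A>|"
    using min_card_attained[of "{\<A>. \<A> \<subseteq> I \<and> (\<forall>K\<in>I. \<exists>A\<in>\<A>. K - A \<in> J)}"]
    unfolding cof_card_def by blast
  \<comment> \<open>\<open>max_card\<close> equals one of its two arguments, so bounding each of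
    them suffices.\<close>
  show ?thesis
    unfolding max_card_def omega1_def \<A>(3)
    using z_card_le_cofinal[OF assms \<A>(1,2)] cardSuc_natLeq_le_cofinal[OF assms \<A>(1,2)]
    by simp
qed

end
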